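(* Let $T$ be a finite tree. Then $\dim_{\mathrm{poc}}(T)\le 3$, and $\dim_{\mathrm{poc}}(T)=3$ if and only if $T$ is not a caterpillar.
   Context: For $\mathbf{x},\mathbf{y}\in\mathbb{R}^d$, $\mathbf{x}\prec\mathbf{y}$ means $x_i<y_i$ for all $i$. For finite $S\subseteq\mathbb{R}^d$, $D_S$ is the digraph on $S$ with an arc $(\mathbf{x},\mathbf{v})$ whenever $\mathbf{v}\prec\mathbf{x}$; by convention $\mathbb{R}^0$ is a single point. The competition graph $C(D)$ of a digraph $D$ has vertex set $V(D)$ and an edge between distinct $x,y$ iff some $z$ has arcs $(x,z),(y,z)$. The partial order competition dimension $\dim_{\mathrm{poc}}(G)$ of a graph $G$ is the smallest nonnegative integer $d$ such that for some nonnegative integer $k$ and some finite $S\subseteq\mathbb{R}^d$, the disjoint union of $G$ and $k$ isolated vertices is isomorphic to $C(D_S)$. A caterpillar is a tree in which removing all leaves leaves a path (possibly empty). *)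

theory Defs
  imports
    "Graph_Theory.Graph_Theory"
    "HOL-Library.FuncSet"
    "HOL-Library.Extended_Nat"
begin

text \<open>
  A finite simple graph is a \<^term>\<open>G :: 'a pair_pre_digraph\<close> with \<^term>\<open>pair_graph G\<close>:
  finite, loopless and symmetric, each undirected edge being a pair of opposite arcs.
\<close>

text \<open>
  The library predicate \<^const>\<open>tree\<close> cannot be used on symmetric digraphs, because there
  a single edge traversed back and forth counts as a cycle. In a finite simple graph, the
  undirected cycles are exactly the directed cycles of length at least 3.
\<close>

definition graph_tree :: "'a pair_pre_digraph \<Rightarrow> bool" where
  "graph_tree G \<longleftrightarrow>
     pair_graph G \<and>
     Digraph_Component.connected (with_proj G) \<and>
     \<not> (\<exists>p. pre_digraph.cycle (with_proj G) p \<and> 3 \<le> length p)"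

text \<open>In a symmetric digraph without parallel arcs, the out-degree is the degree of the graph.\<close>

definition leaves :: "'a pair_pre_digraph \<Rightarrow> 'a set" where
  "leaves G = {v \<in> pverts G. out_degree (with_proj G) v = 1}"

text \<open>The null graph is a path (\<^term>\<open>vs = []\<close>), and so is a single vertex.\<close>

definition path_graph :: "('a, 'b) pre_digraph \<Rightarrow> bool" where
  "path_graph H \<longleftrightarrow>
     (\<exists>vs. distinct vs \<and> verts H = set vs \<and>
        arcs_ends H = {(vs ! i, vs ! j) | i j.
          i < length vs \<and> j < length vs \<and> (j = Suc i \<or> i = Suc j)})"

definition caterpillar :: "'a pair_pre_digraph \<Rightarrow> bool" where
  "caterpillar G \<longleftrightarrow>
     graph_tree G \<and> path_graph (with_proj G \<restriction> (pverts G - leaves G))"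

text \<open>
  As the dimension is quantified inside a formula, the space of real \<open>d\<close>-vectors is the set of
  extensional functions on \<^term>\<open>{..<d}\<close>; for \<^term>\<open>d = 0\<close> it is a single point.
\<close>

definition real_space :: "nat \<Rightarrow> (nat \<Rightarrow> real) set" where
  "real_space d = {..<d} \<rightarrow>\<^sub>E UNIV"

definition prec :: "nat \<Rightarrow> (nat \<Rightarrow> real) \<Rightarrow> (nat \<Rightarrow> real) \<Rightarrow> bool" where
  "prec d x y \<longleftrightarrow> (\<forall>i<d. x i < y i)"

definition dominance_digraph ::
    "nat \<Rightarrow> (nat \<Rightarrow> real) set \<Rightarrow> (nat \<Rightarrow> real) pair_pre_digraph" where
  "dominance_digraph d S =
     \<lparr>pverts = S, parcs = {(x, v). x \<in> S \<and> v \<in> S \<and> prec d v x}\<rparr>"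

definition competition_graph :: "'a pair_pre_digraph \<Rightarrow> 'a pair_pre_digraph" where
  "competition_graph D =
     \<lparr>pverts = pverts D,
      parcs = {(x, y). x \<in> pverts D \<and> y \<in> pverts D \<and> x \<noteq> y \<and>
        (\<exists>z \<in> pverts D. (x, z) \<in> parcs D \<and> (y, z) \<in> parcs D)}\<rparr>"

definition add_isolated :: "nat \<Rightarrow> 'a pair_pre_digraph \<Rightarrow> ('a + nat) pair_pre_digraph" where
  "add_isolated k G =
     \<lparr>pverts = Inl ` pverts G \<union> Inr ` {..<k},
      parcs = {(Inl x, Inl y) | x y. (x, y) \<in> parcs G}\<rparr>"

definition poc_realizable :: "nat \<Rightarrow> 'a pair_pre_digraph \<Rightarrow> bool" where
  "poc_realizable d G \<longleftrightarrow>
     (\<exists>k S. finite S \<and> S \<subseteq> real_space d \<and>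
        digraph_iso (with_proj (add_isolated k G))
                    (with_proj (competition_graph (dominance_digraph d S))))"

text \<open>
  The value is \<open>\<infinity>\<close> if there is no realizing dimension, so that a finite upper bound
  asserts that one exists; otherwise it is the smallest such \<open>d\<close>.
\<close>

definition dim_poc :: "'a pair_pre_digraph \<Rightarrow> enat" where
  "dim_poc G = Inf (enat ` {d. poc_realizable d G})"

end

theory Submission
  imports Defs
begin

text \<open>
  Suppose the vertices carry \<open>d\<close> coordinates such that, for every edge \<open>uv\<close> and every other
  vertex \<open>w\<close>, some coordinate of \<open>w\<close> is below those of both \<open>u\<close> and \<open>v\<close>. Then a point slightly
  below the componentwise minimum of \<open>u\<close> and \<open>v\<close> is a prey of \<open>u\<close> and \<open>v\<close> only, so the graph is
  realizable in dimension \<open>d\<close>. For a tree three coordinates of the form \<open>h, g, - g\<close> do; for a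
  caterpillar two do, namely \<open>r, - l\<close> for a representation by intervals \<open>[l, r]\<close>.

  Conversely, a tree that is not a caterpillar has a vertex with three neighbours that are not
  leaves (consider a longest path among the non-leaves). The prey of the three outer edges of this
  spider are pairwise incomparable points of the plane, and the middle one of them prevents the
  other two legs from being joined through the centre.
\<close>

section \<open>Finite trees as relations\<close>

text \<open>Connectedness takes the form in which it is used later: to reach all of
  \<open>V\<close>, it suffices to exhibit a nonempty set closed under neighbours. Cycles are vertex
  lists, so that segments of paths can be closed up directly.\<close>

locale fin_tree =
  fixes V :: "'a set" and E :: "'a rel"
  assumes finite_V: "finite V"
    and E_subset: "E \<subseteq> V \<times> V" and sym_E: "sym E" and irrefl_E: "irrefl E"
    and closed_subset_eq: "\<lbrakk>W \<subseteq> V; W \<noteq> {}; E `` W \<subseteq> W\<rbrakk> \<Longrightarrow> W = V"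
    and no_cycle: "\<lbrakk>distinct xs; 3 \<le> length xs; successively (\<lambda>x y. (x, y) \<in> E) xs\<rbrakk>
      \<Longrightarrow> (last xs, hd xs) \<notin> E"

text \<open>This lemma and the next two translate vertex lists into the arc lists for which
  \<open>cycle\<close> is defined.\<close>

lemma pcas_vwalk_arcs:
  "ys \<noteq> [] \<Longrightarrow> pcas (hd ys) (vwalk_arcs ys) (last ys)"
  by (induction ys rule: vwalk_arcs.induct) auto

lemma pawalk_verts_vwalk_arcs:
  "ys \<noteq> [] \<Longrightarrow> pawalk_verts (hd ys) (vwalk_arcs ys) = ys"
  by (induction ys rule: vwalk_arcs.induct) auto

lemma set_vwalk_arcs_subset_iff:
  "set (vwalk_arcs ys) \<subseteq> E \<longleftrightarrow> successively (\<lambda>x y. (x, y) \<in> E) ys"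
  by (induction ys rule: vwalk_arcs.induct) auto

lemma fin_tree_of_graph_tree:
  assumes "graph_tree T"
  shows "fin_tree (pverts T) (parcs T)"
proof -
  from assms interpret pair_graph T by (simp add: graph_tree_def)
  have conn: "strongly_connected (with_proj (mk_symmetric (with_proj T)))"
    using assms by (simp add: graph_tree_def connected_def)
  have sym: "sym (parcs T)"
    using pair_sym_arcs by (simp add: symmetric_def)
  \<comment> \<open>\<open>T\<close> is already symmetric, so symmetrizing it for the definition of
    connectedness changes nothing.\<close>
  have mk: "pverts (mk_symmetric (with_proj T)) = pverts T"
    "parcs (mk_symmetric (with_proj T)) = parcs T"
    using symD[OF sym] by (fastforce simp: mk_symmetric_def)+
  show ?thesis
  proof
    show "finite (pverts T)" by simp
    show "parcs T \<subseteq> pverts T \<times> pverts T" by (auto dest: in_arcsD1 in_arcsD2)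
    show "sym (parcs T)" by (fact sym)
    show "irrefl (parcs T)" by (auto simp: irrefl_def dest: no_loops')
  next
    fix W assume W: "W \<subseteq> pverts T" "W \<noteq> {}" "parcs T `` W \<subseteq> W"
    then obtain u where u: "u \<in> W" by blast
    have "v \<in> W" if "v \<in> pverts T" for v
    proof -
      have "(u, v) \<in> rtrancl_on (pverts T) (parcs T)"
        using conn mk u W that by (auto simp: strongly_connected_def reachable_def)
      then show ?thesis
        by (induction rule: rtrancl_on_induct) (use u W in auto)
    qed
    with W show "W = pverts T" by blast
  next
    fix xs assume xs: "distinct xs" "3 \<le> length xs" "successively (\<lambda>x y. (x, y) \<in> parcs T) xs"
    \<comment> \<open>Repeating the head at the end closes the walk and gives it exactly
      \<open>length xs\<close> arcs, so the bound 3 carries over.\<close>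
    let ?ys = "xs @ [hd xs]" and ?p = "vwalk_arcs (xs @ [hd xs])"
    show "(last xs, hd xs) \<notin> parcs T"
    proof
      assume last: "(last xs, hd xs) \<in> parcs T"
      from xs have ne: "xs \<noteq> []" by auto
      have "set ?p \<subseteq> parcs T"
        using xs last ne by (simp add: set_vwalk_arcs_subset_iff successively_append_iff)
      moreover have "pcas (hd xs) ?p (hd xs)" "pawalk_verts (hd xs) ?p = ?ys"
        using pcas_vwalk_arcs[of ?ys] pawalk_verts_vwalk_arcs[of ?ys] ne by auto
      moreover have "hd xs \<in> pverts T"
        using last by (rule in_arcsD2)
      moreover have "distinct (tl ?ys)"
        using xs ne by (cases xs) auto
      moreover have len: "length ?p = length xs"
        using vwalk_length_simp[of ?ys] unfolding vwalk_length_def by simp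
      moreover have "?p \<noteq> []" using len ne by force
      ultimately have "cycle ?p"
        unfolding cycle_def awalk_def by (intro exI[of _ "hd xs"]) auto
      with assms len xs show False by (auto simp: graph_tree_def)
    qed
  qed
qed

section \<open>Realizations\<close>

text \<open>An arc of a pair digraph is the pair of its ends, so the action of an isomorphism on
  arcs is determined by its action on vertices.\<close>

lemma digraph_iso_with_proj_iff:
  assumes "pair_wf_digraph G"
  shows "digraph_iso (with_proj G) (with_proj H) \<longleftrightarrow>
    (\<exists>f. inj_on f (pverts G) \<and> pverts H = f ` pverts G \<and> parcs H = map_prod f f ` parcs G)"
proof
  interpret pair_wf_digraph G by fact
  {
    assume "digraph_iso (with_proj G) (with_proj H)"
    then obtain h where h: "digraph_isomorphism h" "with_proj H = app_iso h (with_proj G)"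
      by (auto simp: digraph_iso_def)
    have "inj_on (iso_verts h) (pverts G)"
      using digraph_isomorphism_inj_on_verts[OF h(1)] .
    moreover have "pverts H = iso_verts h ` pverts G"
      using arg_cong[OF h(2), of verts] by simp
    moreover have "parcs H = map_prod (iso_verts h) (iso_verts h) ` parcs G"
      using arg_cong[OF h(2), of arcs_ends] arcs_ends_app_iso_eq[OF h(1)]
      by (simp add: map_prod_def)
    ultimately show "\<exists>f. inj_on f (pverts G) \<and> pverts H = f ` pverts G \<and>
        parcs H = map_prod f f ` parcs G"
      by blast
  next
    assume "\<exists>f. inj_on f (pverts G) \<and> pverts H = f ` pverts G \<and> parcs H = map_prod f f ` parcs G"
    then obtain f where f: "inj_on f (pverts G)" "pverts H = f ` pverts G"
      "parcs H = map_prod f f ` parcs G" by blast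
    let ?h = "\<lparr>iso_verts = f, iso_arcs = map_prod f f, iso_head = snd, iso_tail = fst\<rparr>"
    have "inj_on (map_prod f f) (parcs G)"
      by (rule inj_on_subset[OF map_prod_inj_on[OF f(1) f(1)]]) (auto dest: in_arcsD1 in_arcsD2)
    then have "digraph_isomorphism ?h"
      using f(1) wf_digraph by (simp add: digraph_isomorphism_def)
    moreover have "with_proj H = app_iso ?h (with_proj G)"
      using f by (simp add: app_iso_def with_proj_def)
    ultimately show "digraph_iso (with_proj G) (with_proj H)"
      unfolding digraph_iso_def by blast
  }
qed

lemma pair_wf_digraph_add_isolated:
  "pair_wf_digraph G \<Longrightarrow> pair_wf_digraph (add_isolated k G)"
  by (auto simp: pair_wf_digraph_def add_isolated_def)

definition common_prey :: "nat \<Rightarrow> (nat \<Rightarrow> real) set \<Rightarrow> (nat \<Rightarrow> real) \<Rightarrow> (nat \<Rightarrow> real) \<Rightarrow> bool" where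
  "common_prey d S x y \<longleftrightarrow> (\<exists>z\<in>S. prec d z x \<and> prec d z y)"

lemma competition_dominance_simps:
  "pverts (competition_graph (dominance_digraph d S)) = S"
  "parcs (competition_graph (dominance_digraph d S)) =
    {(x, y). x \<in> S \<and> y \<in> S \<and> x \<noteq> y \<and> common_prey d S x y}"
  by (auto simp: competition_graph_def dominance_digraph_def common_prey_def)

text \<open>The isolated vertices are forgotten: their points survive only as members of
  \<open>S\<close> that may serve as prey, which is all the lower bound uses.\<close>

lemma poc_realizableE:
  assumes "poc_realizable d G" "pair_wf_digraph G"
  obtains S P where "S \<subseteq> real_space d" "inj_on P (pverts G)" "P ` pverts G \<subseteq> S"
    "\<And>x y. \<lbrakk>x \<in> pverts G; y \<in> pverts G\<rbrakk> \<Longrightarrow>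
      (x, y) \<in> parcs G \<longleftrightarrow> x \<noteq> y \<and> common_prey d S (P x) (P y)"
proof -
  from assms(1) obtain k S where S: "S \<subseteq> real_space d"
    and iso: "digraph_iso (with_proj (add_isolated k G))
      (with_proj (competition_graph (dominance_digraph d S)))"
    by (auto simp: poc_realizable_def)
  from iso obtain f where inj: "inj_on f (pverts (add_isolated k G))"
    and f: "S = f ` pverts (add_isolated k G)"
      "{(x, y). x \<in> S \<and> y \<in> S \<and> x \<noteq> y \<and> common_prey d S x y} =
        map_prod f f ` parcs (add_isolated k G)"
    unfolding digraph_iso_with_proj_iff[OF pair_wf_digraph_add_isolated[OF assms(2)]]
      competition_dominance_simps by (elim exE conjE)
  have mem: "Inl x \<in> pverts (add_isolated k G)" if "x \<in> pverts G" for x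
    using that by (auto simp: add_isolated_def)
  show thesis
  proof (rule that[OF S, of "f \<circ> Inl"])
    show "inj_on (f \<circ> Inl) (pverts G)"
      using inj by (auto simp: inj_on_def add_isolated_def)
    show "(f \<circ> Inl) ` pverts G \<subseteq> S" using mem f(1) by auto
  next
    fix x y assume xy: "x \<in> pverts G" "y \<in> pverts G"
    have "(x, y) \<in> parcs G \<longleftrightarrow> (Inl x, Inl y) \<in> parcs (add_isolated k G)"
      by (auto simp: add_isolated_def)
    also have "\<dots> \<longleftrightarrow> (f (Inl x), f (Inl y)) \<in> map_prod f f ` parcs (add_isolated k G)"
    proof
      assume "(f (Inl x), f (Inl y)) \<in> map_prod f f ` parcs (add_isolated k G)"
      then obtain a b where ab: "(a, b) \<in> parcs (add_isolated k G)"
        "f (Inl x) = f a" "f (Inl y) = f b" by auto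
      moreover have "a \<in> pverts (add_isolated k G)" "b \<in> pverts (add_isolated k G)"
        using ab(1) pair_wf_digraph.in_arcsD1[OF pair_wf_digraph_add_isolated[OF assms(2)]]
          pair_wf_digraph.in_arcsD2[OF pair_wf_digraph_add_isolated[OF assms(2)]] by blast+
      ultimately have "a = Inl x" "b = Inl y"
        using inj_onD[OF inj ab(2)] inj_onD[OF inj ab(3)] mem xy by blast+
      with ab show "(Inl x, Inl y) \<in> parcs (add_isolated k G)" by simp
    qed force
    also have "\<dots> \<longleftrightarrow> f (Inl x) \<noteq> f (Inl y) \<and> common_prey d S (f (Inl x)) (f (Inl y))"
      unfolding f(2)[symmetric] using mem xy by (simp add: f(1))
    also have "f (Inl x) \<noteq> f (Inl y) \<longleftrightarrow> x \<noteq> y"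
      using inj mem xy by (auto simp: inj_on_eq_iff)
    finally show "(x, y) \<in> parcs G \<longleftrightarrow> x \<noteq> y \<and> common_prey d S ((f \<circ> Inl) x) ((f \<circ> Inl) y)"
      by simp
  qed
qed

text \<open>The points of \<open>S\<close> outside the image of \<open>P\<close> become the isolated
  vertices, enumerated by \<open>q\<close>. The assumption \<open>isolated\<close> speaks of
  \<open>s\<close> only; applied to the swapped pair it yields the same for
  \<open>t\<close>.\<close>

lemma poc_realizableI:
  assumes "pair_wf_digraph G" "finite S" "S \<subseteq> real_space d"
    and inj: "inj_on P (pverts G)" and sub: "P ` pverts G \<subseteq> S"
    and edges: "\<And>x y. \<lbrakk>x \<in> pverts G; y \<in> pverts G; x \<noteq> y\<rbrakk> \<Longrightarrow>
      (x, y) \<in> parcs G \<longleftrightarrow> common_prey d S (P x) (P y)"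
    and irrefl: "irrefl (parcs G)"
    and isolated: "\<And>s t. \<lbrakk>s \<in> S; t \<in> S; s \<noteq> t; common_prey d S s t\<rbrakk> \<Longrightarrow> s \<in> P ` pverts G"
  shows "poc_realizable d G"
proof -
  let ?R = "S - P ` pverts G"
  obtain q where q: "bij_betw q {..<card ?R} ?R"
    using ex_bij_betw_nat_finite[of ?R] assms(2) by (auto simp: lessThan_atLeast0)
  have q_inj: "inj_on q {..<card ?R}" and q_image: "q ` {..<card ?R} = ?R"
    using q by (simp_all add: bij_betw_def)
  have q_neq: "P x \<noteq> q n" if "x \<in> pverts G" "n < card ?R" for x n
    using q_image that by blast
  let ?f = "case_sum P q" and ?A = "add_isolated (card ?R) G"
  have sym: "common_prey d S t s" if "common_prey d S s t" for s t
    using that by (auto simp: common_prey_def)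
  have "inj_on ?f (pverts ?A)"
    unfolding add_isolated_def pair_pre_digraph.select_convs inj_on_Un
  proof (intro conjI)
    show "inj_on ?f (Inl ` pverts G)" "inj_on ?f (Inr ` {..<card ?R})"
      using inj q_inj by (simp_all add: inj_on_def)
    show "?f ` (Inl ` pverts G - Inr ` {..<card ?R}) \<inter>
        ?f ` (Inr ` {..<card ?R} - Inl ` pverts G) = {}"
      using q_neq by auto
  qed
  moreover have "S = ?f ` pverts ?A"
  proof -
    have "?f ` pverts ?A = P ` pverts G \<union> q ` {..<card ?R}"
      by (simp add: add_isolated_def image_Un image_image)
    then show ?thesis using sub by (simp add: q_image Un_absorb1)
  qed
  moreover have "{(x, y). x \<in> S \<and> y \<in> S \<and> x \<noteq> y \<and> common_prey d S x y} =
      map_prod ?f ?f ` parcs ?A"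
  proof safe
    fix s t assume st: "s \<in> S" "t \<in> S" "s \<noteq> t" "common_prey d S s t"
    then obtain x y where xy: "x \<in> pverts G" "y \<in> pverts G" "s = P x" "t = P y"
      using isolated[of s t] isolated[of t s] sym by blast
    then have "(Inl x, Inl y) \<in> parcs ?A"
      using edges st by (auto simp: add_isolated_def)
    then show "(s, t) \<in> map_prod ?f ?f ` parcs ?A" using xy by (auto intro: image_eqI[of _ _ "(Inl x, Inl y)"])
  next
    fix a b assume "(a, b) \<in> parcs ?A"
    then obtain x y where xy: "a = Inl x" "b = Inl y" "(x, y) \<in> parcs G"
      by (auto simp: add_isolated_def)
    then have V: "x \<in> pverts G" "y \<in> pverts G" "x \<noteq> y"
      using pair_wf_digraph.in_arcsD1[OF assms(1)] pair_wf_digraph.in_arcsD2[OF assms(1)] irrefl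
      by (auto simp: irrefl_def)
    then show "?f a \<in> S" "?f b \<in> S" "common_prey d S (?f a) (?f b)"
      using xy sub edges by auto
    show "False" if "?f a = ?f b" using that xy V inj by (auto simp: inj_on_eq_iff)
  qed
  ultimately have "digraph_iso (with_proj ?A)
      (with_proj (competition_graph (dominance_digraph d S)))"
    unfolding digraph_iso_with_proj_iff[OF pair_wf_digraph_add_isolated[OF assms(1)]]
      competition_dominance_simps by (intro exI[of _ ?f] conjI)
  with assms(2,3) show ?thesis
    unfolding poc_realizable_def by blast
qed


section \<open>From separating coordinates to a realization\<close>

lemma finite_gap:
  fixes X :: "real set"
  assumes "finite X"
  obtains e where "0 < e" "\<And>x y. \<lbrakk>x \<in> X; y \<in> X; x < y\<rbrakk> \<Longrightarrow> x \<le> y - e"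
proof -
  let ?D = "{y - x | x y. x \<in> X \<and> y \<in> X \<and> x < y}"
  have "?D \<subseteq> (\<lambda>(x, y). y - x) ` (X \<times> X)" by auto
  \<comment> \<open>The extra element 1 keeps the set nonempty when \<open>X\<close> has no two
    distinct elements.\<close>
  then have fin: "finite (insert 1 ?D)"
    using assms finite_subset by fastforce
  show thesis
  proof (rule that)
    show "0 < Min (insert 1 ?D)"
      using fin by (subst Min_gr_iff) auto
    fix x y assume "x \<in> X" "y \<in> X" "x < y"
    then have "Min (insert 1 ?D) \<le> y - x"
      by (intro Min_le fin) auto
    then show "x \<le> y - Min (insert 1 ?D)" by simp
  qed
qed

lemma prec_trans: "\<lbrakk>prec d x y; prec d y z\<rbrakk> \<Longrightarrow> prec d x z"
  by (force simp: prec_def)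

lemma not_prec_self: "0 < d \<Longrightarrow> \<not> prec d x x"
  by (auto simp: prec_def)

text \<open>The realizing set consists of the vertex points and one prey point per edge. The work
  lies in excluding accidental competition: no vertex point may be prey of two vertices, and no prey
  point may have prey itself. Since \<open>sep\<close> does not compare the two ends of an edge,
  \<open>neq\<close> is what gives them different points.\<close>

lemma poc_realizable_of_separation:
  fixes f :: "'a \<Rightarrow> nat \<Rightarrow> real"
  assumes "pair_graph G" "0 < d"
    and nonisolated: "\<And>v. v \<in> pverts G \<Longrightarrow> \<exists>u. (v, u) \<in> parcs G"
    and neq: "\<And>u v. (u, v) \<in> parcs G \<Longrightarrow> \<exists>i<d. f u i \<noteq> f v i"
    and sep: "\<And>u v w. \<lbrakk>(u, v) \<in> parcs G; w \<in> pverts G; w \<noteq> u; w \<noteq> v\<rbrakk> \<Longrightarrow>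
      \<exists>i<d. f w i < f u i \<and> f w i < f v i"
  shows "poc_realizable d G"
proof -
  interpret pair_graph G by fact
  let ?V = "pverts G" and ?E = "parcs G"
  have "finite (\<Union>v\<in>?V. f v ` {..<d})" by simp
  then obtain e where e: "0 < e" "\<And>u w i. \<lbrakk>u \<in> ?V; w \<in> ?V; i < d; f w i < f u i\<rbrakk> \<Longrightarrow>
      f w i \<le> f u i - e"
    by (rule finite_gap) blast
  define P where "P v = restrict (f v) {..<d}" for v
  define Q where "Q u v = (\<lambda>i\<in>{..<d}. min (f u i) (f v i) - e)" for u v
  define S where "S = P ` ?V \<union> case_prod Q ` ?E"
  have Q_sym: "Q u v = Q v u" for u v
    by (simp add: Q_def min.commute)
  \<comment> \<open>For a third vertex \<open>w\<close>, \<open>sep\<close> gives a coordinate where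
    \<open>w\<close> is below \<open>u\<close> and \<open>v\<close>; by the gap it is still at or
    below \<open>Q u v\<close> there, so \<open>Q u v\<close> is not below
    \<open>P w\<close>.\<close>
  have prec_QP: "prec d (Q u v) (P w) \<longleftrightarrow> w = u \<or> w = v" if uv: "(u, v) \<in> ?E" and w: "w \<in> ?V" for u v w
  proof
    assume pr: "prec d (Q u v) (P w)"
    show "w = u \<or> w = v"
    proof (rule ccontr)
      assume "\<not> ?thesis"
      then obtain i where i: "i < d" "f w i < f u i" "f w i < f v i"
        using sep[OF uv w] by blast
      then have "f w i \<le> min (f u i) (f v i) - e"
        using e(2)[of u w i] e(2)[of v w i] w in_arcsD1[OF uv] in_arcsD2[OF uv] by (simp add: min_def)
      with pr i show False by (auto simp: prec_def P_def Q_def)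
    qed
  qed (use e(1) in \<open>auto simp: prec_def P_def Q_def min_def\<close>)
  \<comment> \<open>The hypotheses are contradictory. The prey of an edge at \<open>w\<close> is
    also below \<open>P x\<close> and \<open>P y\<close>, so \<open>x\<close> and \<open>y\<close>
    are the two ends of that edge; one of them is \<open>w\<close>, which would lie below
    itself.\<close>
  have below_P: "x = w" if "prec d (P w) (P x)" "prec d (P w) (P y)" "x \<noteq> y"
    "w \<in> ?V" "x \<in> ?V" "y \<in> ?V" for w x y
  proof -
    obtain w' where w': "(w, w') \<in> ?E" using nonisolated \<open>w \<in> ?V\<close> by blast
    have "prec d (Q w w') (P w)" using prec_QP[OF w'] that by simp
    then have "prec d (Q w w') (P x)" "prec d (Q w w') (P y)" using that prec_trans by blast+
    then have "x = w \<or> x = w'" "y = w \<or> y = w'" using prec_QP[OF w'] that by auto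
    then have "x = w \<or> y = w" using that by blast
    with that assms(2) show ?thesis using not_prec_self by blast
  qed
  have no_common_P: "\<not> (prec d (P w) (P x) \<and> prec d (P w) (P y))" if "x \<noteq> y"
    "w \<in> ?V" "x \<in> ?V" "y \<in> ?V" for w x y
    using below_P[of w x y] that not_prec_self[OF assms(2)] by blast
  \<comment> \<open>By transitivity \<open>z\<close> is a common prey of \<open>u\<close> and
    \<open>v\<close>, hence the prey point of an edge with the same ends, that is,
    \<open>Q u v\<close> itself.\<close>
  have no_prey: "\<not> prec d z (Q u v)" if uv: "(u, v) \<in> ?E" and z: "z \<in> S" for u v z
  proof
    assume pr: "prec d z (Q u v)"
    have V: "u \<in> ?V" "v \<in> ?V" "u \<noteq> v" using uv by (auto dest: in_arcsD1 in_arcsD2 no_loops')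
    have "prec d (Q u v) (P u)" "prec d (Q u v) (P v)" using prec_QP[OF uv] V by auto
    with pr have zuv: "prec d z (P u)" "prec d z (P v)" using prec_trans by blast+
    from z consider w where "w \<in> ?V" "z = P w" | a b where "(a, b) \<in> ?E" "z = Q a b"
      by (auto simp: S_def)
    then show False
    proof cases
      case 1 then show False using no_common_P zuv V by blast
    next
      case 2
      then have "u = a \<or> u = b" "v = a \<or> v = b" using prec_QP zuv V by auto
      then have "z = Q u v" using V 2 Q_sym by auto
      with pr show False using not_prec_self assms(2) by blast
    qed
  qed
  show ?thesis
  proof (rule poc_realizableI)
    show "pair_wf_digraph G" by unfold_locales
    show "finite S" by (simp add: S_def)
    show "S \<subseteq> real_space d" by (auto simp: S_def real_space_def P_def Q_def split: if_splits)
    show "P ` ?V \<subseteq> S" by (auto simp: S_def)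
    show "irrefl ?E" by (auto simp: irrefl_def dest: no_loops')
    show "inj_on P ?V"
    proof (rule inj_onI, rule ccontr)
      fix x y assume xy: "x \<in> ?V" "y \<in> ?V" "P x = P y" "x \<noteq> y"
      \<comment> \<open>The prey of an edge at \<open>x\<close> lies below \<open>P y\<close> as
        well, so \<open>y\<close> is the other end of that edge.\<close>
      obtain x' where x': "(x, x') \<in> ?E" using nonisolated xy by blast
      have "y = x'" using prec_QP[OF x'] xy by metis
      with neq[OF x'] obtain i where "i < d" "f x i \<noteq> f y i" by blast
      with fun_cong[OF xy(3), of i] show False by (simp add: P_def)
    qed
  next
    fix x y assume xy: "x \<in> ?V" "y \<in> ?V" "x \<noteq> y"
    show "(x, y) \<in> ?E \<longleftrightarrow> common_prey d S (P x) (P y)"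
    proof
      assume E: "(x, y) \<in> ?E"
      then have "Q x y \<in> S" by (force simp: S_def)
      then show "common_prey d S (P x) (P y)"
        unfolding common_prey_def using prec_QP[OF E] xy by blast
    next
      assume "common_prey d S (P x) (P y)"
      then obtain z where z: "z \<in> S" "prec d z (P x)" "prec d z (P y)"
        by (auto simp: common_prey_def)
      then obtain a b where "(a, b) \<in> ?E" "z = Q a b"
        using no_common_P xy by (auto simp: S_def)
      then show "(x, y) \<in> ?E"
        using prec_QP z xy arcs_symmetric by blast
    qed
  next
    fix s t assume s: "s \<in> S" "common_prey d S s t"
    then obtain z where "z \<in> S" "prec d z s" by (auto simp: common_prey_def)
    then have "s \<noteq> Q u v" if "(u, v) \<in> ?E" for u v using no_prey that by blast
    with s(1) show "s \<in> P ` ?V" by (auto simp: S_def)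
  qed
qed

section \<open>The spider has no planar realization\<close>

text \<open>\<open>w1\<close>, \<open>w2\<close>, \<open>w3\<close> are prey of the outer edges at
  \<open>a1\<close>, \<open>a2\<close>, \<open>a3\<close>, and \<open>z1\<close>, \<open>z3\<close>
  are prey of the edges joining \<open>c\<close> to \<open>a1\<close> and \<open>a3\<close>. Since
  \<open>w2\<close> is not below \<open>c\<close>, the point of \<open>c\<close> is bounded by
  \<open>w2\<close> in one of the two coordinates, and this forces \<open>z1\<close> or
  \<open>z3\<close> below \<open>a2\<close>.\<close>

lemma spider_middle:
  fixes X Y :: "'p \<Rightarrow> real"
  assumes adj: "\<And>x y z. \<lbrakk>x \<in> V; y \<in> V; x \<noteq> y; z \<in> S; X z < X (P x); Y z < Y (P x);
      X z < X (P y); Y z < Y (P y)\<rbrakk> \<Longrightarrow> (x, y) \<in> E"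
    and V: "a1 \<in> V" "a2 \<in> V" "a3 \<in> V"
    and neq: "a1 \<noteq> a2" "a2 \<noteq> a3"
    and indep: "(a1, a2) \<notin> E" "(a3, a2) \<notin> E"
    and w: "w1 \<in> S" "X w1 < X (P a1)" "Y w1 < Y (P a1)"
      "w2 \<in> S" "X w2 < X (P a2)" "Y w2 < Y (P a2)" "\<not> (X w2 < X (P c) \<and> Y w2 < Y (P c))"
      "w3 \<in> S" "X w3 < X (P a3)" "Y w3 < Y (P a3)"
    and z: "z1 \<in> S" "X z1 < X (P a1)" "Y z1 < Y (P a1)" "X z1 < X (P c)" "Y z1 < Y (P c)"
      "z3 \<in> S" "X z3 < X (P a3)" "Y z3 < Y (P a3)" "X z3 < X (P c)" "Y z3 < Y (P c)"
    and le: "X w1 \<le> X w2" "X w2 \<le> X w3"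
  shows False
proof -
  have 1: "\<not> (X s < X (P a1) \<and> Y s < Y (P a1) \<and> X s < X (P a2) \<and> Y s < Y (P a2))"
    and 3: "\<not> (X s < X (P a3) \<and> Y s < Y (P a3) \<and> X s < X (P a2) \<and> Y s < Y (P a2))" if "s \<in> S" for s
    using adj[of a1 a2 s] adj[of a3 a2 s] that V neq indep by auto
  \<comment> \<open>Otherwise \<open>w1\<close> would be below \<open>a2\<close> as well as
    \<open>a1\<close>.\<close>
  have "Y w2 < Y w1" using 1[of w1] w le by auto
  then have X1: "X (P a1) \<le> X w2" using 1[of w2] w by auto
  have Y3: "Y (P a3) \<le> Y w2" using 3[of w2] w le by auto
  show False
  \<comment> \<open>If \<open>c\<close> is weakly left of \<open>w2\<close>, then \<open>z3\<close>
    is left of \<open>w2\<close> because of \<open>c\<close> and lower than it because of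
    \<open>a3\<close>, hence below \<open>a2\<close>. Otherwise \<open>c\<close> is weakly lower
    than \<open>w2\<close>, and \<open>z1\<close> is below \<open>a2\<close> in the same
    way.\<close>
  proof (cases "X (P c) \<le> X w2")
    case True then show False using 3[of z3] z w Y3 by auto
  next
    case False then show False using 1[of z1] z w X1 by auto
  qed
qed

lemma spider_not_realizable:
  assumes "d \<le> 2" "S \<subseteq> real_space d" and inj: "inj_on P V" "P ` V \<subseteq> S"
    and E: "\<And>x y. \<lbrakk>x \<in> V; y \<in> V\<rbrakk> \<Longrightarrow> (x, y) \<in> E \<longleftrightarrow> x \<noteq> y \<and> common_prey d S (P x) (P y)"
    and "E \<subseteq> V \<times> V"
    and triangle_free: "\<And>x y z. \<lbrakk>(x, y) \<in> E; (y, z) \<in> E\<rbrakk> \<Longrightarrow> (x, z) \<notin> E"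
    and a: "\<And>i. i < 3 \<Longrightarrow> (c, a i) \<in> E" "inj_on a {..<3 :: nat}"
    and b: "\<And>i. i < 3 \<Longrightarrow> (a i, b i) \<in> E \<and> b i \<noteq> c"
  shows False
proof (cases "d = 0")
  case True
  \<comment> \<open>The space of dimension 0 has one point, so \<open>P\<close> would identify the
    distinct vertices \<open>c\<close> and \<open>a 0\<close>.\<close>
  then have "S \<subseteq> {\<lambda>_. undefined}" using assms(2) by (simp add: real_space_def)
  with inj(2) have P: "P x = (\<lambda>_. undefined)" if "x \<in> V" for x using that by blast
  have "c \<in> V" "a 0 \<in> V" using a(1)[of 0] assms(6) by auto
  then have "c = a 0" using inj_onD[OF inj(1)] P by metis
  then show False using E[of c c] a(1)[of 0] \<open>c \<in> V\<close> by auto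
next
  case False
  \<comment> \<open>For \<open>d = 1\<close> both projections are the only coordinate.\<close>
  define X Y :: "(nat \<Rightarrow> real) \<Rightarrow> real" where "X x = x 0" and "Y x = x (d - 1)" for x
  have "{..<d} = {0, d - 1}" using assms(1) False by auto
  then have prec: "prec d x y \<longleftrightarrow> X x < X y \<and> Y x < Y y" for x y
    unfolding prec_def X_def Y_def by (metis insert_iff lessThan_iff singletonD)
  have sym: "(y, x) \<in> E" if "(x, y) \<in> E" for x y
    using that E[of x y] E[of y x] assms(6) by (auto simp: common_prey_def)
  have V: "c \<in> V" "a i \<in> V" "b i \<in> V" if "i < 3" for i
    using a(1)[OF that] b[OF that] assms(6) E by blast+
  have "\<exists>w. w \<in> S \<and> prec d w (P (a i)) \<and> prec d w (P (b i))" if "i < 3" for i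
    using b[OF that] E V[OF that] by (auto simp: common_prey_def)
  then obtain w where w: "w i \<in> S" "prec d (w i) (P (a i))" "prec d (w i) (P (b i))" if "i < 3" for i
    by metis
  have "\<exists>z. z \<in> S \<and> prec d z (P (a i)) \<and> prec d z (P c)" if "i < 3" for i
    using a(1)[OF that] E V[OF that] by (auto simp: common_prey_def)
  then obtain z where z: "z i \<in> S" "prec d (z i) (P (a i))" "prec d (z i) (P c)" if "i < 3" for i
    by metis
  \<comment> \<open>Otherwise \<open>c\<close> and \<open>b i\<close> would be adjacent and form a
    triangle with \<open>a i\<close>.\<close>
  have wc: "\<not> prec d (w i) (P c)" if i: "i < 3" for i
  proof
    assume "prec d (w i) (P c)"
    then have "(c, b i) \<in> E" using E[of c "b i"] V[OF i] b[OF i] w[OF i] by (auto simp: common_prey_def)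
    then show False using triangle_free a(1)[OF i] b[OF i] by blast
  qed
  have indep: "(a i, a j) \<notin> E" if "i < 3" "j < 3" for i j
    using triangle_free[of "a i" c "a j"] a(1) sym that by blast
  have mid: "\<not> (X (w i) \<le> X (w j) \<and> X (w j) \<le> X (w k))"
    if ijk: "i < 3" "j < 3" "k < 3" "i \<noteq> j" "j \<noteq> k" for i j k
  proof (rule notI, elim conjE)
    assume le: "X (w i) \<le> X (w j)" "X (w j) \<le> X (w k)"
    show False
    proof (rule spider_middle[where V = V and E = E and S = S and X = X and Y = Y and P = P
          and c = c and ?a1.0 = "a i" and ?a2.0 = "a j" and ?a3.0 = "a k" and ?w1.0 = "w i"
          and ?w2.0 = "w j" and ?w3.0 = "w k" and ?z1.0 = "z i" and ?z3.0 = "z k"])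
      show "a i \<noteq> a j" "a j \<noteq> a k" using a(2) ijk by (auto dest: inj_onD)
    next
      fix x y z assume "x \<in> V" "y \<in> V" "x \<noteq> y" "z \<in> S" "X z < X (P x)" "Y z < Y (P x)"
        "X z < X (P y)" "Y z < Y (P y)"
      then show "(x, y) \<in> E" using E[of x y] by (auto simp: common_prey_def prec)
    next
      show "\<not> (X (w j) < X (P c) \<and> Y (w j) < Y (P c))" using wc[OF ijk(2)] by (simp add: prec)
    qed (use V[OF ijk(1)] V[OF ijk(2)] V[OF ijk(3)] w[OF ijk(1)] w[OF ijk(2)] w[OF ijk(3)]
        z[OF ijk(1)] z[OF ijk(3)] le indep[OF ijk(1,2)] indep[OF ijk(3,2)] in
        \<open>simp_all add: prec\<close>)
  qed
  \<comment> \<open>The six orders of three reals are exhaustive, so some \<open>w i\<close> always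
    has the middle first coordinate.\<close>
  have "\<not> (X (w 0) \<le> X (w 1) \<and> X (w 1) \<le> X (w 2))" "\<not> (X (w 0) \<le> X (w 2) \<and> X (w 2) \<le> X (w 1))"
    "\<not> (X (w 1) \<le> X (w 0) \<and> X (w 0) \<le> X (w 2))" "\<not> (X (w 1) \<le> X (w 2) \<and> X (w 2) \<le> X (w 0))"
    "\<not> (X (w 2) \<le> X (w 0) \<and> X (w 0) \<le> X (w 1))" "\<not> (X (w 2) \<le> X (w 1) \<and> X (w 1) \<le> X (w 0))"
    using mid[of 0 1 2] mid[of 0 2 1] mid[of 1 0 2] mid[of 1 2 0] mid[of 2 0 1] mid[of 2 1 0]
    by simp_all
  then show False by (meson linear)
qed

section \<open>Paths and coordinates in trees\<close>

context fin_tree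
begin

abbreviation adjacent :: "'a \<Rightarrow> 'a \<Rightarrow> bool" where
  "adjacent x y \<equiv> (x, y) \<in> E"

lemma adjacent_sym: "adjacent x y \<Longrightarrow> adjacent y x"
  using sym_E by (rule symD)

lemma not_adjacent_self: "\<not> adjacent x x"
  using irrefl_E by (simp add: irrefl_def)

lemma adjacent_in_V: "adjacent x y \<Longrightarrow> x \<in> V \<and> y \<in> V"
  using E_subset by blast

lemma triangle_free: "\<lbrakk>adjacent x y; adjacent y z\<rbrakk> \<Longrightarrow> \<not> adjacent x z"
  using no_cycle[of "[x, y, z]"] not_adjacent_self adjacent_sym by auto

section \<open>Paths inside a set of vertices\<close>

definition path_in :: "'a set \<Rightarrow> 'a list \<Rightarrow> bool" where
  "path_in W xs \<longleftrightarrow> xs \<noteq> [] \<and> distinct xs \<and> set xs \<subseteq> W \<and> successively adjacent xs"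

lemma path_in_rev: "path_in W xs \<Longrightarrow> path_in W (rev xs)"
  using adjacent_sym by (auto simp: path_in_def elim: successively_mono)

text \<open>A chord between non-consecutive vertices would close the segment between them to a
  cycle.\<close>

lemma path_in_chord:
  assumes "path_in W xs" "i < j" "j < length xs" "adjacent (xs ! i) (xs ! j)"
  shows "j = Suc i"
proof (rule ccontr)
  assume ne: "j \<noteq> Suc i"
  let ?ys = "drop i (take (Suc j) xs)"
  have len: "3 \<le> length ?ys" using assms ne by auto
  have split: "xs = take i xs @ ?ys @ drop (Suc j) xs"
    using assms append_take_drop_id[of i "take (Suc j) xs"] append_take_drop_id[of "Suc j" xs]
    by (simp add: min_absorb1 flip: append_assoc)
  have "distinct ?ys" using assms(1) by (simp add: path_in_def)
  moreover have "successively adjacent ?ys"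
    using assms(1) split unfolding path_in_def by (metis successively_append_iff)
  moreover have "hd ?ys = xs ! i" using assms by (simp add: hd_drop_conv_nth)
  moreover have "last ?ys = xs ! j" using assms by (simp add: last_drop last_conv_nth)
  ultimately show False
    using no_cycle[of ?ys] len adjacent_sym[OF assms(4)] by simp
qed

lemma longest_path_in:
  assumes "W \<subseteq> V" "W \<noteq> {}"
  obtains xs where "path_in W xs" "\<And>ys. path_in W ys \<Longrightarrow> length ys \<le> length xs"
proof -
  from assms obtain v where "v \<in> W" by blast
  then have "path_in W [v]" by (simp add: path_in_def)
  moreover have "\<forall>ys. path_in W ys \<longrightarrow> length ys < Suc (card V)"
    using assms(1) finite_V unfolding path_in_def
    by (metis card_mono distinct_card subset_trans less_Suc_eq_le)
  ultimately show thesis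
    using ex_has_greatest_nat[of "path_in W" "[v]" length "Suc (card V)"] that by metis
qed

text \<open>An end of a longest path in \<open>W\<close> works: by maximality its neighbours in
  \<open>W\<close> lie on the path, and for lack of chords only the second vertex qualifies. If the
  path has one vertex, the value of \<open>u\<close> is arbitrary and there is no neighbour in
  \<open>W\<close>.\<close>

lemma ex_vertex_of_degree_le_1:
  assumes "W \<subseteq> V" "W \<noteq> {}"
  obtains v u where "v \<in> W" "\<And>x. \<lbrakk>x \<in> W; adjacent v x\<rbrakk> \<Longrightarrow> x = u"
proof -
  obtain xs where xs: "path_in W xs" and max: "\<And>ys. path_in W ys \<Longrightarrow> length ys \<le> length xs"
    using longest_path_in[OF assms] by blast
  have ne: "xs \<noteq> []" using xs by (simp add: path_in_def)
  show thesis
  proof (rule that)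
    show "hd xs \<in> W" using xs by (auto simp: path_in_def)
    fix x assume x: "x \<in> W" "adjacent (hd xs) x"
    have "x \<in> set xs"
    proof (rule ccontr)
      assume "x \<notin> set xs"
      then have "path_in W (x # xs)"
        using xs x adjacent_sym by (auto simp: path_in_def successively_Cons)
      then show False using max by fastforce
    qed
    then obtain j where j: "j < length xs" "x = xs ! j" by (auto simp: in_set_conv_nth)
    have "j \<noteq> 0" using j x not_adjacent_self ne by (metis hd_conv_nth)
    then have "j = Suc 0" using path_in_chord[OF xs, of 0 j] j x ne by (auto simp: hd_conv_nth)
    with j show "x = xs ! Suc 0" by simp
  qed
qed

text \<open>The disjuncts are separation in the coordinates \<open>h\<close>, \<open>g\<close> and
  \<open>- g\<close>. Injectivity of \<open>g\<close> makes its comparisons strict, which keeps the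
  induction going and tells the ends of an edge apart.\<close>

definition separates :: "('a \<Rightarrow> real) \<Rightarrow> ('a \<Rightarrow> real) \<Rightarrow> 'a set \<Rightarrow> bool" where
  "separates g h W \<longleftrightarrow> inj_on g W \<and>
    (\<forall>x\<in>W. \<forall>y\<in>W. \<forall>w\<in>W. adjacent x y \<longrightarrow> w \<noteq> x \<longrightarrow> w \<noteq> y \<longrightarrow>
      h w < h x \<and> h w < h y \<or> g w < g x \<and> g w < g y \<or> g x < g w \<and> g y < g w)"

text \<open>
  The vertices are inserted one at a time, each adjacent to at most one vertex \<open>u\<close> inserted
  before. The new vertex is lower in \<open>h\<close> than everything else and sits just below \<open>u\<close> in \<open>g\<close>.
\<close>

lemma ex_separates:
  assumes "W \<subseteq> V"
  shows "\<exists>g h. separates g h W"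
  using assms
proof (induction "card W" arbitrary: W)
  case 0
  then have "W = {}" using finite_V finite_subset by fastforce
  then show ?case by (simp add: separates_def)
next
  case (Suc n)
  have fin: "finite W" using Suc.prems finite_V finite_subset by blast
  have "W \<noteq> {}" using Suc.hyps(2) by auto
  then obtain v u0 where v: "v \<in> W" and u0: "\<And>x. \<lbrakk>x \<in> W; adjacent v x\<rbrakk> \<Longrightarrow> x = u0"
    using ex_vertex_of_degree_le_1[OF Suc.prems] by blast
  define W' where "W' = W - {v}"
  have W: "W = insert v W'" "v \<notin> W'" "finite W'" using v fin by (auto simp: W'_def)
  have "n = card W'" "W' \<subseteq> V" using Suc W by auto
  from Suc.hyps(1)[OF this] obtain g h where gh: "separates g h W'" by blast
  then have inj: "inj_on g W'" by (simp add: separates_def)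
  show ?case
  proof (cases "W' = {}")
    case True
    then show ?thesis using W not_adjacent_self by (auto simp: separates_def)
  next
    case False
    \<comment> \<open>If \<open>u0\<close> is not in \<open>W'\<close>, then \<open>v\<close> has no
      neighbour there and any element of \<open>W'\<close> can play the role of
      \<open>u\<close>.\<close>
    then obtain u where u: "u \<in> W'" and nbr: "\<And>x. \<lbrakk>x \<in> W'; adjacent v x\<rbrakk> \<Longrightarrow> x = u"
      using u0 W by (metis ex_in_conv insertCI)
    from W(3) have "finite (g ` W')" by simp
    then obtain e where e: "0 < e" "\<And>x y. \<lbrakk>x \<in> g ` W'; y \<in> g ` W'; x < y\<rbrakk> \<Longrightarrow> x \<le> y - e"
      by (rule finite_gap) blast
    \<comment> \<open>Half the gap places \<open>v\<close> strictly between \<open>u\<close> and the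
      next smaller value of \<open>g\<close>.\<close>
    define g' where "g' = g(v := g u - e / 2)"
    define h' where "h' = h(v := Min (h ` W') - 1)"
    have old: "g' x = g x" "h' x = h x" if "x \<in> W'" for x
      using that W by (auto simp: g'_def h'_def)
    have low: "h' v < h' x" if "x \<in> W'" for x
    proof -
      have "Min (h ` W') \<le> h x" using that W by simp
      then show ?thesis using old[OF that] by (simp add: h'_def)
    qed
    have below: "g' x < g' v" if "x \<in> W'" "g x < g u" for x
      using e(1) e(2)[of "g x" "g u"] that u W(2) by (auto simp: g'_def)
    have above: "g' v < g' u" using e(1) old[OF u] by (simp add: g'_def)
    \<comment> \<open>No old value lies between those of \<open>v\<close> and \<open>u\<close>, so
      every other vertex is on the same side of both; this settles the new edge. For old edges and
      \<open>w = v\<close>, the low value of \<open>h'\<close> suffices.\<close>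
    have sep_u: "g' w < g' u \<and> g' w < g' v \<or> g' u < g' w \<and> g' v < g' w" if "w \<in> W'" "w \<noteq> u" for w
    proof (cases "g w < g u")
      case True then show ?thesis using below[OF that(1)] above by simp
    next
      case False
      then have "g u < g w" using inj_onD[OF inj] u that by (metis linorder_neqE_linordered_idom)
      then show ?thesis using old u that above by auto
    qed
    show ?thesis
      unfolding separates_def
    proof (rule exI[of _ g'], rule exI[of _ h'], intro conjI ballI impI)
      have "g' v \<noteq> g' x" if "x \<in> W'" for x
        using sep_u[OF that] above by (cases "x = u") auto
      moreover have "inj_on g' W'"
        using inj old by (simp add: inj_on_def)
      ultimately show "inj_on g' W"
        unfolding W(1) by (auto simp: inj_on_insert)
    next
      fix x y w assume "x \<in> W" "y \<in> W" "w \<in> W" and xy: "adjacent x y" and w: "w \<noteq> x" "w \<noteq> y"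
      then consider "x \<in> W'" "y \<in> W'" "w \<in> W'" | "w = v" "x \<in> W'" "y \<in> W'"
        | "w \<in> W'" "x = v" "y \<in> W'" | "w \<in> W'" "x \<in> W'" "y = v"
        using W not_adjacent_self by blast
      then show "h' w < h' x \<and> h' w < h' y \<or> g' w < g' x \<and> g' w < g' y \<or> g' x < g' w \<and> g' y < g' w"
      proof cases
        case 1 then show ?thesis using gh 1 xy w old by (simp add: separates_def)
      next
        case 2 then show ?thesis using low by simp
      next
        case 3 then show ?thesis using nbr sep_u[of w] xy w by blast
      next
        case 4 then show ?thesis using nbr[OF _ adjacent_sym[OF xy[unfolded 4]]] sep_u[of w] w by blast
      qed
    qed
  qed
qed

section \<open>Leaves and the graph on the non-leaves\<close>

lemma ex_neighbour:
  assumes "v \<in> V" "V \<noteq> {v}"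
  shows "\<exists>u. adjacent v u"
  using closed_subset_eq[of "{v}"] assms by blast

lemma adjacent_leaves:
  assumes "E `` {u} = {v}" "E `` {v} = {u}"
  shows "V = {u, v}"
  using closed_subset_eq[of "{u, v}"] assms adjacent_in_V by blast

text \<open>Take a longest path in \<open>N\<close>. If it misses part of \<open>N\<close>,
  connectedness yields a vertex of \<open>N\<close> off the path but adjacent to it. By maximality
  it is attached at an interior vertex, which thus has three neighbours in \<open>N\<close>.\<close>

lemma induced_path_or_branching:
  assumes "N \<subseteq> V" and leaf: "\<And>v. v \<in> V - N \<Longrightarrow> \<exists>u. E `` {v} = {u}"
  shows "(\<exists>vs. distinct vs \<and> N = set vs \<and>
      E \<inter> N \<times> N = {(vs ! i, vs ! j) | i j. i < length vs \<and> j < length vs \<and> (j = Suc i \<or> i = Suc j)}) \<or>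
    (\<exists>c a. inj_on a {..<3 :: nat} \<and> (\<forall>i<3. a i \<in> N \<and> adjacent c (a i)))"
proof (cases "N = {}")
  case True
  then show ?thesis by (intro disjI1 exI[of _ "[]"]) auto
next
  case False
  obtain vs where vs: "path_in N vs" and max: "\<And>ys. path_in N ys \<Longrightarrow> length ys \<le> length vs"
    using longest_path_in[OF assms(1) False] by blast
  have ne: "vs \<noteq> []" and dist: "distinct vs" and sub: "set vs \<subseteq> N" using vs by (auto simp: path_in_def)
  have step: "adjacent (vs ! i) (vs ! Suc i)" if "Suc i < length vs" for i
    using vs that by (auto simp: path_in_def successively_conv_nth)
  have E_vs: "adjacent (vs ! i) (vs ! j) \<longleftrightarrow> j = Suc i \<or> i = Suc j"
    if "i < length vs" "j < length vs" for i j
    using path_in_chord[OF vs, of i j] path_in_chord[OF vs, of j i] that adjacent_sym step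
      not_adjacent_self by (metis linorder_neqE_nat)
  show ?thesis
  proof (cases "N = set vs")
    case True
    have "E \<inter> N \<times> N =
        {(vs ! i, vs ! j) | i j. i < length vs \<and> j < length vs \<and> (j = Suc i \<or> i = Suc j)}"
      (is "_ = ?R")
    proof (intro equalityI subsetI)
      fix p assume "p \<in> E \<inter> N \<times> N"
      then obtain i j where "i < length vs" "j < length vs" "p = (vs ! i, vs ! j)" "p \<in> E"
        using True by (auto simp: in_set_conv_nth)
      then show "p \<in> ?R" using E_vs[of i j] by blast
    next
      fix p assume "p \<in> ?R"
      then obtain i j where "i < length vs" "j < length vs" "p = (vs ! i, vs ! j)" "j = Suc i \<or> i = Suc j"
        by blast
      then show "p \<in> E \<inter> N \<times> N" using E_vs[of i j] True by simp
    qed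
    then show ?thesis using True dist by blast
  next
    case neq: False
    have "\<exists>x y. x \<in> set vs \<and> y \<in> N - set vs \<and> adjacent x y"
    proof (rule ccontr)
      assume none: "\<not> ?thesis"
      \<comment> \<open>The path and the leaves attached to it are closed under adjacency.\<close>
      let ?R = "set vs \<union> {v \<in> V - N. E `` {v} \<subseteq> set vs}"
      have "E `` ?R \<subseteq> ?R"
      proof
        fix y assume "y \<in> E `` ?R"
        then obtain x where x: "x \<in> ?R" "adjacent x y" by blast
        show "y \<in> ?R"
        proof (cases "x \<in> set vs \<and> y \<notin> N")
          case True
          have "y \<in> V - N" using True adjacent_in_V[OF x(2)] by simp
          moreover from leaf[OF this] obtain u where "E `` {y} = {u}" by blast
          moreover have "x \<in> E `` {y}" using adjacent_sym[OF x(2)] by simp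
          ultimately show ?thesis using True by simp
        next
          case False
          show ?thesis
          proof (cases "x \<in> set vs")
            case True
            then show ?thesis using False none x(2) by blast
          next
            case False
            then show ?thesis using x by auto
          qed
        qed
      qed
      then have "?R = V" using sub assms(1) ne by (intro closed_subset_eq) auto
      then show False using neq sub assms(1) by blast
    qed
    then obtain i y where i: "i < length vs" and y: "y \<in> N" "y \<notin> set vs" "adjacent (vs ! i) y"
      by (auto simp: in_set_conv_nth)
    \<comment> \<open>Allowing any \<open>ws\<close> on the same vertices covers the path and its
      reversal, hence both ends.\<close>
    have no_ext: "\<not> adjacent y (hd ws)" if "path_in N ws" "set ws = set vs" "length ws = length vs" for ws
    proof
      assume "adjacent y (hd ws)"
      then have "path_in N (y # ws)" using that y by (auto simp: path_in_def successively_Cons)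
      then show False using max that by fastforce
    qed
    have "i \<noteq> 0"
      using no_ext[OF vs] adjacent_sym[OF y(3)] ne by (metis hd_conv_nth)
    moreover have "Suc i \<noteq> length vs"
      using no_ext[OF path_in_rev[OF vs]] adjacent_sym[OF y(3)] ne
      by (metis diff_Suc_1 hd_rev last_conv_nth length_rev set_rev)
    ultimately have i': "Suc (i - 1) = i" "Suc i < length vs" using i by auto
    define a where "a = (!) [vs ! (i - 1), vs ! Suc i, y]"
    have a: "a 0 = vs ! (i - 1)" "a 1 = vs ! Suc i" "a 2 = y"
      by (simp_all add: a_def)
    have less3: "k = 0 \<or> k = 1 \<or> k = 2" if "k < 3" for k :: nat using that by auto
    have neq_a: "a 0 \<noteq> a 1" "a 0 \<noteq> a 2" "a 1 \<noteq> a 2"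
      using y(2) i' dist unfolding a by (auto simp: nth_eq_iff_index_eq)
    have "inj_on a {..<3}"
    proof (rule inj_onI)
      fix k l :: nat assume "k \<in> {..<3}" "l \<in> {..<3}" "a k = a l"
      then show "k = l" using less3[of k] less3[of l] neq_a by auto
    qed
    moreover have "a k \<in> N \<and> adjacent (vs ! i) (a k)" if "k < 3" for k
    proof -
      have "vs ! (i - 1) \<in> N" "vs ! Suc i \<in> N" using sub i' i by auto
      then show ?thesis
        using less3[OF that] a y E_vs[of i "i - 1"] E_vs[of i "Suc i"] i' i by auto
    qed
    ultimately show ?thesis by blast
  qed
qed

end

section \<open>Interval coordinates for caterpillars\<close>

lemma ex_inj_on_unit_interval:
  assumes "finite A"
  obtains t :: "'a \<Rightarrow> real" where "inj_on t A" "\<And>x. 0 < t x" "\<And>x. t x < 1"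
proof -
  obtain f :: "'a \<Rightarrow> nat" where f: "inj_on f A"
    using finite_imp_inj_to_nat_seg[OF assms] by blast
  show thesis
    by (rule that[of "\<lambda>x. 1 / (real (f x) + 2)"]) (use f in \<open>auto simp: inj_on_def field_simps\<close>)
qed

text \<open>The intervals \<open>[l, r]\<close> of two adjacent vertices will share exactly one
  point; the final disjunction then says that the interval of \<open>w\<close> misses that
  point.\<close>

lemma (in fin_tree) ex_interval_coordinates:
  assumes "distinct vs"
    and spine: "\<And>i j. \<lbrakk>i < length vs; j < length vs; adjacent (vs ! i) (vs ! j)\<rbrakk> \<Longrightarrow> j = Suc i \<or> i = Suc j"
    and leaf: "\<And>v. v \<in> V - set vs \<Longrightarrow> \<exists>p\<in>set vs. E `` {v} = {p}"
  shows "\<exists>(l :: 'a \<Rightarrow> real) (r :: 'a \<Rightarrow> real). (\<forall>u v. adjacent u v \<longrightarrow> r u \<noteq> r v \<or> l u \<noteq> l v) \<and>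
    (\<forall>u v w. adjacent u v \<longrightarrow> w \<in> V \<longrightarrow> w \<noteq> u \<longrightarrow> w \<noteq> v \<longrightarrow>
      r w < r u \<and> r w < r v \<or> l u < l w \<and> l v < l w)"
proof -
  define pos where "pos = the_inv_into {..<length vs} ((!) vs)"
  have "inj_on ((!) vs) {..<length vs}"
    using assms(1) by (simp add: inj_on_nth)
  then have pos: "pos (vs ! i) = i" if "i < length vs" for i
    using that by (simp add: pos_def the_inv_into_f_f)
  have pos_inj: "u = v" if "u \<in> set vs" "v \<in> set vs" "pos u = pos v" for u v
    using that pos by (auto simp: in_set_conv_nth)
  obtain t :: "'a \<Rightarrow> real" where t: "inj_on t V" "\<And>x. 0 < t x" "\<And>x. t x < 1"
    using ex_inj_on_unit_interval[OF finite_V] by blast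
  obtain p where p: "\<And>v. v \<in> V - set vs \<Longrightarrow> p v \<in> set vs \<and> E `` {v} = {p v}"
    using leaf by metis
  \<comment> \<open>The \<open>i\<close>-th spine vertex gets \<open>[i, i + 1]\<close>; its leaves get distinct points in the interior.\<close>
  define l where "l v = (if v \<in> set vs then real (pos v) else real (pos (p v)) + t v)" for v
  define r where "r v = (if v \<in> set vs then real (pos v) + 1 else real (pos (p v)) + t v)" for v
  let ?ok = "\<lambda>u v. (r u \<noteq> r v \<or> l u \<noteq> l v) \<and>
    (\<forall>w\<in>V. w \<noteq> u \<longrightarrow> w \<noteq> v \<longrightarrow> r w < r u \<and> r w < r v \<or> l u < l w \<and> l v < l w)"
  \<comment> \<open>The shared point is the integer \<open>pos v\<close>. Leaves sit at non-integral
    points, and no other spine interval has this endpoint.\<close>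
  have spine_ok: "?ok u v" if uv: "u \<in> set vs" "v \<in> set vs" "pos v = Suc (pos u)" for u v
  proof (intro conjI ballI impI)
    show "r u \<noteq> r v \<or> l u \<noteq> l v" using uv by (simp add: l_def)
    fix w assume w: "w \<in> V" "w \<noteq> u" "w \<noteq> v"
    show "r w < r u \<and> r w < r v \<or> l u < l w \<and> l v < l w"
    proof (cases "w \<in> set vs")
      case True
      then have "pos w \<noteq> pos u" "pos w \<noteq> pos v" using pos_inj uv w by blast+
      then show ?thesis using True uv by (simp add: l_def r_def) linarith
    next
      case False
      have "pos (p w) \<le> pos u \<or> Suc (pos u) \<le> pos (p w)" by linarith
      then show ?thesis using False uv t(2)[of w] t(3)[of w] by (simp add: l_def r_def) linarith
    qed
  qed
  \<comment> \<open>The shared point is the leaf itself, interior to the interval of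
    \<open>u\<close>. Other spine intervals miss that interior, and other leaves differ by their
    integer part or by \<open>t\<close>.\<close>
  have leaf_ok: "?ok u v" if uv: "u \<in> set vs" "v \<in> V - set vs" "p v = u" for u v
  proof (intro conjI ballI impI)
    show "r u \<noteq> r v \<or> l u \<noteq> l v" using uv t(2)[of v] by (simp add: l_def)
    fix w assume w: "w \<in> V" "w \<noteq> u" "w \<noteq> v"
    show "r w < r u \<and> r w < r v \<or> l u < l w \<and> l v < l w"
    proof (cases "w \<in> set vs")
      case True
      then have "pos w \<noteq> pos u" using pos_inj uv w by blast
      then show ?thesis using True uv t(2)[of v] t(3)[of v] by (simp add: l_def r_def) linarith
    next
      case False
      have "t w \<noteq> t v" using inj_onD[OF t(1)] w uv by blast
      then show ?thesis
        using False uv t(2)[of v] t(3)[of v] t(2)[of w] t(3)[of w]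
        by (cases "pos (p w)" "pos u" rule: linorder_cases) (simp_all add: l_def r_def, linarith+)
    qed
  qed
  have ok_sym: "?ok v u" if "?ok u v" for u v using that by auto
  have "?ok u v" if uv: "adjacent u v" for u v
  proof -
    have V: "u \<in> V" "v \<in> V" using adjacent_in_V[OF uv] by auto
    consider "u \<in> set vs" "v \<in> set vs" | "v \<in> V - set vs" | "u \<in> V - set vs" using V by blast
    then show ?thesis
    proof cases
      case 1
      then obtain i j where ij: "i < length vs" "j < length vs" "u = vs ! i" "v = vs ! j"
        by (auto simp: in_set_conv_nth)
      then have "pos v = Suc (pos u) \<or> pos u = Suc (pos v)" using spine uv pos by simp
      then show ?thesis using spine_ok 1 ok_sym by blast
    next
      case 2
      have "u \<in> E `` {v}" using adjacent_sym[OF uv] by simp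
      then have "p v = u" using p[OF 2] by simp
      then show ?thesis using leaf_ok p[OF 2] 2 by blast
    next
      case 3
      have "v \<in> E `` {u}" using uv by simp
      then have "p u = v" using p[OF 3] by simp
      then show ?thesis using ok_sym[OF leaf_ok] p[OF 3] 3 by blast
    qed
  qed
  then have 1: "\<forall>u v. adjacent u v \<longrightarrow> r u \<noteq> r v \<or> l u \<noteq> l v"
    and 2: "\<forall>u v w. adjacent u v \<longrightarrow> w \<in> V \<longrightarrow> w \<noteq> u \<longrightarrow> w \<noteq> v \<longrightarrow>
      r w < r u \<and> r w < r v \<or> l u < l w \<and> l v < l w"
    by simp_all
  show ?thesis
    by (rule exI[of _ l], rule exI[of _ r], rule conjI[OF 1 2])
qed

section \<open>Dimensions of trees\<close>

text \<open>A nonempty set of extended naturals attains its infimum, and the empty one has infimum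
  infinity. Monotonicity of realizability in \<open>d\<close> is not presupposed, hence the
  quantifier over all smaller \<open>d\<close>.\<close>

lemma dim_poc_le_iff: "dim_poc G \<le> enat n \<longleftrightarrow> (\<exists>d\<le>n. poc_realizable d G)"
proof
  let ?A = "enat ` {d. poc_realizable d G}"
  assume le: "dim_poc G \<le> enat n"
  have "?A \<noteq> {}"
  proof
    assume "?A = {}"
    then have "dim_poc G = \<infinity>" by (simp add: dim_poc_def Inf_enat_def)
    with le show False by simp
  qed
  then have "dim_poc G \<in> ?A"
    unfolding dim_poc_def Inf_enat_def by (metis LeastI ex_in_conv)
  with le show "\<exists>d\<le>n. poc_realizable d G" by auto
next
  assume "\<exists>d\<le>n. poc_realizable d G"
  then obtain d where d: "d \<le> n" "poc_realizable d G" by blast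
  then have "dim_poc G \<le> enat d" unfolding dim_poc_def by (intro Inf_lower) simp
  also have "\<dots> \<le> enat n" using d by simp
  finally show "dim_poc G \<le> enat n" .
qed

text \<open>The separation criterion asks that every vertex have a neighbour, so the one-vertex tree
  is treated apart.\<close>

lemma poc_realizable_singleton:
  assumes "pair_graph G" "pverts G = {v}"
  shows "poc_realizable d G"
proof -
  interpret pair_graph G by fact
  let ?o = "\<lambda>i\<in>{..<d}. 0 :: real"
  show ?thesis
  proof (rule poc_realizableI)
    show "pair_wf_digraph G" by unfold_locales
    show "finite {?o}" by simp
    show "{?o} \<subseteq> real_space d" by (simp add: real_space_def)
    show "irrefl (parcs G)" by (auto simp: irrefl_def dest: no_loops')
  qed (use assms(2) in auto)
qed

lemma leaves_altdef: "leaves G = {v \<in> pverts G. \<exists>u. parcs G `` {v} = {u}}"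
proof -
  have "out_degree (with_proj G) v = card (parcs G `` {v})" for v
  proof -
    have "out_arcs (with_proj G) v = Pair v ` (parcs G `` {v})"
      by (auto simp: out_arcs_def)
    then show ?thesis by (simp add: out_degree_def card_image inj_on_def)
  qed
  then show ?thesis by (auto simp: leaves_def card_1_singleton_iff)
qed

lemma arcs_ends_induce_subgraph_with_proj:
  "arcs_ends (with_proj G \<restriction> N) = parcs G \<inter> N \<times> N"
  by (auto simp: arcs_ends_conv induce_subgraph_def image_iff)

lemma poc_realizable_3_tree:
  assumes "graph_tree T"
  shows "poc_realizable 3 T"
proof -
  from assms have G: "pair_graph T" by (simp add: graph_tree_def)
  interpret fin_tree "pverts T" "parcs T" using assms by (rule fin_tree_of_graph_tree)
  show ?thesis
  proof (cases "\<exists>v. pverts T = {v}")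
    case True
    then show ?thesis using poc_realizable_singleton[OF G] by blast
  next
    case False
    obtain g h where gh: "separates g h (pverts T)" using ex_separates[of "pverts T"] by blast
    define f where "f v = (!) [h v, g v, - g v]" for v
    have f: "f v 0 = h v" "f v (Suc 0) = g v" "f v 2 = - g v" for v by (simp_all add: f_def)
    show ?thesis
    proof (rule poc_realizable_of_separation[OF G, of 3 f])
      show "\<exists>u. adjacent v u" if "v \<in> pverts T" for v
        using ex_neighbour[OF that] False by blast
    next
      fix u v assume uv: "adjacent u v"
      then have "g u \<noteq> g v"
        using gh adjacent_in_V[OF uv] not_adjacent_self[of u] by (auto simp: separates_def inj_on_def)
      then show "\<exists>i<3. f u i \<noteq> f v i" by (intro exI[of _ 1]) (simp add: f)
    next
      fix u v w assume uvw: "adjacent u v" "w \<in> pverts T" "w \<noteq> u" "w \<noteq> v"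
      then have "h w < h u \<and> h w < h v \<or> g w < g u \<and> g w < g v \<or> g u < g w \<and> g v < g w"
        using gh adjacent_in_V[OF uvw(1)] by (simp add: separates_def)
      then consider "f w 0 < f u 0 \<and> f w 0 < f v 0" | "f w (Suc 0) < f u (Suc 0) \<and> f w (Suc 0) < f v (Suc 0)"
        | "f w 2 < f u 2 \<and> f w 2 < f v 2" by (auto simp: f)
      then show "\<exists>i<3. f w i < f u i \<and> f w i < f v i"
        by cases (force intro: exI[of _ "0::nat"] exI[of _ "Suc 0"] exI[of _ "2::nat"])+
    qed simp
  qed
qed

lemma poc_realizable_2_caterpillar:
  assumes "caterpillar T"
  shows "poc_realizable 2 T"
proof -
  from assms have tree: "graph_tree T" by (simp add: caterpillar_def)
  then have G: "pair_graph T" by (simp add: graph_tree_def)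
  interpret fin_tree "pverts T" "parcs T" using tree by (rule fin_tree_of_graph_tree)
  let ?V = "pverts T" and ?E = "parcs T"
  have "\<exists>(l :: 'a \<Rightarrow> real) (r :: 'a \<Rightarrow> real). (\<forall>u v. adjacent u v \<longrightarrow> r u \<noteq> r v \<or> l u \<noteq> l v) \<and>
    (\<forall>u v w. adjacent u v \<longrightarrow> w \<in> ?V \<longrightarrow> w \<noteq> u \<longrightarrow> w \<noteq> v \<longrightarrow>
      r w < r u \<and> r w < r v \<or> l u < l w \<and> l v < l w)"
  \<comment> \<open>Two adjacent leaves make up the whole tree. Then the spine is empty and leaves
    have no spine neighbour to sit on, so this case gets coordinates of its own.\<close>
  proof (cases "\<exists>u\<in>leaves T. \<exists>v\<in>leaves T. adjacent u v")
    case True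
    then obtain u v where uv: "u \<in> leaves T" "v \<in> leaves T" "adjacent u v" by blast
    have leaf: "?E `` {x} = {y}" if "x \<in> leaves T" "adjacent x y" for x y
    proof -
      obtain z where "?E `` {x} = {z}" using \<open>x \<in> leaves T\<close> by (auto simp: leaves_altdef)
      with that(2) show ?thesis by (metis Image_singleton_iff singletonD)
    qed
    have "?E `` {u} = {v}" "?E `` {v} = {u}"
      using leaf uv adjacent_sym by blast+
    then have V: "?V = {u, v}" by (rule adjacent_leaves)
    have neq: "x = u \<and> y = v \<or> x = v \<and> y = u" if "adjacent x y" for x y
      using adjacent_in_V[OF that] that V not_adjacent_self[of x] by auto
    have "u \<noteq> v" using uv not_adjacent_self by blast
    show ?thesis
    proof (rule exI[of _ "\<lambda>x. if x = u then 0 else 1"], rule exI[of _ "\<lambda>_. 0"], intro conjI allI impI)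
      fix x y assume "adjacent x y"
      then show "(0 :: real) \<noteq> 0 \<or> (if x = u then 0 else 1 :: real) \<noteq> (if y = u then 0 else 1)"
        using neq[of x y] \<open>u \<noteq> v\<close> by auto
    next
      fix x y w assume "adjacent x y" "w \<in> ?V" "w \<noteq> x" "w \<noteq> y"
      then have False using neq[of x y] V by auto
      then show "(0 :: real) < 0 \<and> (0 :: real) < 0 \<or>
        (if x = u then 0 else 1 :: real) < (if w = u then 0 else 1) \<and>
        (if y = u then 0 else 1 :: real) < (if w = u then 0 else 1)" ..
    qed
  next
    case False
    from assms obtain vs where vs: "distinct vs" "?V - leaves T = set vs"
      "?E \<inter> (?V - leaves T) \<times> (?V - leaves T) =
        {(vs ! i, vs ! j) | i j. i < length vs \<and> j < length vs \<and> (j = Suc i \<or> i = Suc j)}"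
      by (auto simp: caterpillar_def path_graph_def arcs_ends_induce_subgraph_with_proj)
    show ?thesis
    proof (rule ex_interval_coordinates[OF vs(1)])
      fix i j assume ij: "i < length vs" "j < length vs" "adjacent (vs ! i) (vs ! j)"
      then have "(vs ! i, vs ! j) \<in> ?E \<inter> (?V - leaves T) \<times> (?V - leaves T)"
        using vs(2) by auto
      then obtain i' j' where "i' < length vs" "j' < length vs" "j' = Suc i' \<or> i' = Suc j'"
        "vs ! i = vs ! i'" "vs ! j = vs ! j'"
        unfolding vs(3) by blast
      then show "j = Suc i \<or> i = Suc j" using ij vs(1) by (simp add: nth_eq_iff_index_eq)
    next
      fix v assume v: "v \<in> ?V - set vs"
      then have leaf: "v \<in> leaves T" using vs(2) by blast
      then obtain p where p: "?E `` {v} = {p}" by (auto simp: leaves_altdef)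
      then have "adjacent v p" by blast
      \<comment> \<open>As no two leaves are adjacent, the neighbour of a leaf is on the
        spine.\<close>
      then have "p \<in> set vs" using False leaf adjacent_in_V vs(2) by blast
      with p show "\<exists>p\<in>set vs. ?E `` {v} = {p}" by blast
    qed
  qed
  then obtain l r :: "'a \<Rightarrow> real" where neq: "\<And>u v. adjacent u v \<Longrightarrow> r u \<noteq> r v \<or> l u \<noteq> l v"
    and sep: "\<And>u v w. \<lbrakk>adjacent u v; w \<in> ?V; w \<noteq> u; w \<noteq> v\<rbrakk> \<Longrightarrow>
      r w < r u \<and> r w < r v \<or> l u < l w \<and> l v < l w"
    by blast
  show ?thesis
  proof (cases "\<exists>v. ?V = {v}")
    case True
    then show ?thesis using poc_realizable_singleton[OF G] by blast
  next
    case False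
    define f where "f v = (!) [r v, - l v]" for v
    have f: "f v 0 = r v" "f v (Suc 0) = - l v" for v by (simp_all add: f_def)
    have ex2: "\<exists>i<2. Q i" if "Q 0 \<or> Q 1" for Q :: "nat \<Rightarrow> bool"
      using that by (auto intro: exI[of _ "0::nat"] exI[of _ "1::nat"])
    show ?thesis
    proof (rule poc_realizable_of_separation[OF G, of 2 f])
      show "\<exists>u. adjacent v u" if "v \<in> ?V" for v
        using ex_neighbour[OF that] False by blast
    next
      fix u v assume "adjacent u v"
      then show "\<exists>i<2. f u i \<noteq> f v i" using neq[of u v] by (intro ex2) (simp add: f)
    next
      fix u v w assume "adjacent u v" "w \<in> ?V" "w \<noteq> u" "w \<noteq> v"
      then show "\<exists>i<2. f w i < f u i \<and> f w i < f v i" using sep[of u v w] by (intro ex2) (simp add: f)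
    qed simp
  qed
qed

lemma caterpillar_of_poc_realizable:
  assumes "graph_tree T" "poc_realizable d T" "d \<le> 2"
  shows "caterpillar T"
proof -
  interpret fin_tree "pverts T" "parcs T" using assms(1) by (rule fin_tree_of_graph_tree)
  let ?V = "pverts T" and ?E = "parcs T"
  have wf: "pair_wf_digraph T" using assms(1)
    by (auto simp: graph_tree_def pair_graph_def pair_digraph_def pair_fin_digraph_def)
  obtain S P where S: "S \<subseteq> real_space d" "inj_on P ?V" "P ` ?V \<subseteq> S"
    "\<And>x y. \<lbrakk>x \<in> ?V; y \<in> ?V\<rbrakk> \<Longrightarrow> adjacent x y \<longleftrightarrow> x \<noteq> y \<and> common_prey d S (P x) (P y)"
    using poc_realizableE[OF assms(2) wf] by blast
  let ?N = "?V - leaves T"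
  have "\<nexists>c a. inj_on a {..<3 :: nat} \<and> (\<forall>i<3. a i \<in> ?N \<and> adjacent c (a i))"
  proof
    assume "\<exists>c a. inj_on a {..<3 :: nat} \<and> (\<forall>i<3. a i \<in> ?N \<and> adjacent c (a i))"
    then obtain c a where a: "inj_on a {..<3 :: nat}"
      "\<And>i. i < 3 \<Longrightarrow> a i \<in> ?N" "\<And>i. i < 3 \<Longrightarrow> adjacent c (a i)" by blast
    \<comment> \<open>\<open>a i\<close> is not a leaf but has the neighbour \<open>c\<close>, so it
      has a second one; these complete the legs of the spider.\<close>
    have "\<exists>b. adjacent (a i) b \<and> b \<noteq> c" if i: "i < 3" for i
    proof (rule ccontr)
      assume "\<not> ?thesis"
      then have "?E `` {a i} = {c}" using adjacent_sym[OF a(3)[OF i]] by blast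
      then show False using a(2)[OF i] by (auto simp: leaves_altdef)
    qed
    then obtain b where b: "\<And>i. i < 3 \<Longrightarrow> adjacent (a i) (b i) \<and> b i \<noteq> c" by metis
    show False
      by (rule spider_not_realizable[OF assms(3) S E_subset triangle_free a(3,1) b])
  qed
  moreover have "\<exists>u. ?E `` {v} = {u}" if "v \<in> ?V - ?N" for v
    using that by (auto simp: leaves_altdef)
  ultimately have "\<exists>vs. distinct vs \<and> ?N = set vs \<and> ?E \<inter> ?N \<times> ?N =
      {(vs ! i, vs ! j) | i j. i < length vs \<and> j < length vs \<and> (j = Suc i \<or> i = Suc j)}"
    using induced_path_or_branching[of ?N] by blast
  then show ?thesis
    using assms(1) by (simp add: caterpillar_def path_graph_def arcs_ends_induce_subgraph_with_proj)
qed

theorem theorem3p15: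
  fixes T :: "'a pair_pre_digraph"
  assumes "graph_tree T"
  shows "dim_poc T \<le> 3 \<and> (dim_poc T = 3 \<longleftrightarrow> \<not> caterpillar T)"
proof -
  have le: "dim_poc T \<le> enat 3"
    using poc_realizable_3_tree[OF assms] by (auto simp: dim_poc_le_iff)
  have "caterpillar T \<longleftrightarrow> dim_poc T \<le> enat 2"
    using poc_realizable_2_caterpillar caterpillar_of_poc_realizable[OF assms]
    by (auto simp: dim_poc_le_iff)
  moreover have "dim_poc T = enat 3 \<longleftrightarrow> \<not> dim_poc T \<le> enat 2"
    using le by (cases "dim_poc T") auto
  ultimately show ?thesis using le by (simp flip: numeral_eq_enat)
qed

end
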